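(* For $d\ge2$, the multicorn family $f_c(z)=\overline z^{\,d}+c$, $c\in\mathbb C$, has $d+1$ values of $c$, given by $$c_\tau=(d+1)\,d^{-\frac d{d-1}}\,e^{i\frac\pi{d+1}}\,\tau,\qquad\tau^{d+1}=1,$$ for which the point $z_\tau=d^{-\frac1{d-1}}e^{i\frac\pi{d+1}}\tau$ is an antiholomorphic parabolic point of codimension $2$. The family is generic around these points when considering the real and imaginary parts of $c$ as parameters. The parabolic fixed points occurring for other parameter values of $c$ have codimension $1$, and the $2$-parameter family contains a generic unfolding around these points.
   Context: A fixed point $z_0$ of an antiholomorphic map $f$ (i.e. $\partial f/\partial z=0$) is (antiholomorphically) parabolic if it is a multiple fixed point of finite multiplicity (here equivalently $|\partial f/\partial\overline z(z_0)|=1$). It has codimension $k$ if there is a local holomorphic coordinate at $z_0$ in which $f$ has the form $\overline z\pm\frac12\overline z^{\,k+1}+o(\overline z^{\,k+1})$ (the sign being $+$ if $k$ is odd); the multiplicity is then $k+1$. A family depending real-analytically on $k$ real parameters $\eta\in(\mathbb R^k,0)$ and unfolding a parabolic point of codimension $k$ is generic if, in a local coordinate holomorphic in $z$ and real-analytic in $\eta$ in which it has the form $$f_\eta(z)=\overline z+\sum_{j=0}^{k+1}a_j(\eta)\overline z^{\,j}\pm\tfrac12\overline z^{\,k+1}+o(\overline z^{\,k+1}),\qquad a_j(0)=0,$$ the map $\eta\mapsto(\mathrm{Re}(a_0),\dots,\mathrm{Re}(a_{k-1}))$ is invertible (a local diffeomorphism at $0$). In the codimension $2$ case $\eta$ is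 $(\mathrm{Re}(c-c_\tau),\mathrm{Im}(c-c_\tau))$. In the codimension $1$ case, containing a generic unfolding means that some real-analytic one-parameter subfamily of $f_c$ through the given parameter value is a generic unfolding of the codimension $1$ parabolic point. *)

theory Defs
  imports "HOL-Complex_Analysis.Complex_Analysis" "HOL-Library.Landau_Symbols"
begin

section \<open>Real-analytic maps and local diffeomorphisms\<close>

text \<open>Near \<open>x0\<close> the map is the sum of a convergent power series in the coordinates of
  \<open>x - x0\<close>; the multi-indices are the functions from \<open>Basis\<close> to the naturals.
  Convergence is unconditional, hence absolute for finite-dimensional values.\<close>

definition real_analytic_at :: "('a::euclidean_space \<Rightarrow> 'b::real_normed_vector) \<Rightarrow> 'a \<Rightarrow> bool"
  where "real_analytic_at f x0 \<longleftrightarrow>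
    (\<exists>C :: ('a \<Rightarrow> nat) \<Rightarrow> 'b. \<forall>\<^sub>F x in nhds x0.
       ((\<lambda>\<alpha>. (\<Prod>b\<in>Basis. ((x - x0) \<bullet> b) ^ \<alpha> b) *\<^sub>R C \<alpha>) has_sum f x)
         (Basis \<rightarrow>\<^sub>E UNIV))"

definition C1_on :: "('a::euclidean_space \<Rightarrow> 'b::euclidean_space) \<Rightarrow> 'a set \<Rightarrow> bool"
  where "C1_on f U \<longleftrightarrow>
    (\<exists>f' :: 'a \<Rightarrow> 'a \<Rightarrow>\<^sub>L 'b. (\<forall>x\<in>U. (f has_derivative blinfun_apply (f' x)) (at x)) \<and>
       continuous_on U f')"

text \<open>For a real-analytic map a local inverse of class \<open>C\<^sup>1\<close> is automatically
  real-analytic, so below it does not matter which smoothness class is taken here.\<close>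

definition local_diffeomorphism_at ::
    "('a::euclidean_space \<Rightarrow> 'b::euclidean_space) \<Rightarrow> 'a \<Rightarrow> bool"
  where "local_diffeomorphism_at f x0 \<longleftrightarrow>
    (\<exists>U V g. open U \<and> x0 \<in> U \<and> open V \<and> homeomorphism U V f g \<and> C1_on f U \<and> C1_on g V)"

section \<open>Parabolic points of antiholomorphic maps\<close>

text \<open>\<open>\<partial>f/\<partial>z = 0\<close> is the Cauchy-Riemann equation for the complex conjugate of \<open>f\<close>.\<close>

definition antiholomorphic_at :: "(complex \<Rightarrow> complex) \<Rightarrow> complex \<Rightarrow> bool"
  where "antiholomorphic_at f z0 \<longleftrightarrow> (\<lambda>z. cnj (f z)) analytic_on {z0}"

text \<open>The multiplicity of a fixed point of an antiholomorphic \<open>f\<close> is its multiplicity as a fixed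
  point of the holomorphic map \<open>f \<circ> f\<close>: writing \<open>f z = h (cnj z)\<close> with \<open>h\<close> holomorphic, it is the
  intersection multiplicity of \<open>z = h w\<close> and \<open>w = cnj (h (cnj z))\<close>. It is finite iff \<open>f \<circ> f\<close> is
  not the identity near the point.\<close>

definition parabolic_fixed_point :: "(complex \<Rightarrow> complex) \<Rightarrow> complex \<Rightarrow> bool"
  where "parabolic_fixed_point f z0 \<longleftrightarrow>
    antiholomorphic_at f z0 \<and> f z0 = z0 \<and>
    (\<exists>\<^sub>F z in at z0. f (f z) \<noteq> z) \<and> zorder (\<lambda>z. f (f z) - z) z0 \<ge> 2"

definition normal_form_sign :: "nat \<Rightarrow> complex \<Rightarrow> bool"
  where "normal_form_sign k s \<longleftrightarrow> (s = 1 \<or> s = -1) \<and> (odd k \<longrightarrow> s = 1)"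

text \<open>In the coordinate \<open>w = \<phi> z\<close> the map \<open>f\<close> reads \<open>\<phi> \<circ> f \<circ> \<phi>\<^sup>-\<^sup>1\<close>; its expansion in
  \<open>w\<close> at \<open>0\<close> is written in terms of \<open>z\<close> at \<open>z0\<close>, which avoids the local inverse.\<close>

definition parabolic_of_codim :: "nat \<Rightarrow> (complex \<Rightarrow> complex) \<Rightarrow> complex \<Rightarrow> bool"
  where "parabolic_of_codim k f z0 \<longleftrightarrow>
    parabolic_fixed_point f z0 \<and>
    (\<exists>\<phi> s. \<phi> analytic_on {z0} \<and> \<phi> z0 = 0 \<and> deriv \<phi> z0 \<noteq> 0 \<and> normal_form_sign k s \<and>
       (\<lambda>z. \<phi> (f z) - (cnj (\<phi> z) + s / 2 * cnj (\<phi> z) ^ (k + 1)))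
         \<in> o[at z0](\<lambda>z. cnj (\<phi> z) ^ (k + 1)))"

section \<open>Generic unfoldings\<close>

definition holomorphic_family_at ::
    "('p::euclidean_space \<Rightarrow> complex \<Rightarrow> complex) \<Rightarrow> complex \<Rightarrow> bool"
  where "holomorphic_family_at \<Phi> z0 \<longleftrightarrow>
    real_analytic_at (\<lambda>(\<eta>, z). \<Phi> \<eta> z) (0, z0) \<and>
    (\<exists>r>0. \<forall>\<eta>\<in>ball 0 r. \<Phi> \<eta> holomorphic_on ball z0 r)"

text \<open>The parameter space is a Euclidean space \<open>'p\<close> of dimension \<open>k\<close>, and \<open>f \<eta>\<close> is the map
  at parameter \<open>\<eta>\<close>. The coordinate \<open>w = \<Phi> \<eta> z\<close> may move with \<open>\<eta>\<close>: its origin \<open>w = 0\<close> is the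
  point \<open>z = \<zeta> \<eta>\<close>. The bijection \<open>e\<close> numbers the coordinates of \<open>'p\<close> by \<open>0, \<dots>, k - 1\<close>; the
  choice of numbering is immaterial.\<close>

definition generic_unfolding ::
    "('p::euclidean_space \<Rightarrow> complex \<Rightarrow> complex) \<Rightarrow> complex \<Rightarrow> bool"
  where "generic_unfolding f z0 \<longleftrightarrow> (let k = DIM('p) in
    holomorphic_family_at (\<lambda>\<eta> z. cnj (f \<eta> z)) z0 \<and>
    parabolic_of_codim k (f 0) z0 \<and>
    (\<exists>\<Phi> \<zeta> a s e.
       holomorphic_family_at \<Phi> z0 \<and> deriv (\<Phi> 0) z0 \<noteq> 0 \<and>
       \<zeta> 0 = z0 \<and> isCont \<zeta> 0 \<and> (\<forall>\<^sub>F \<eta> in nhds 0. \<Phi> \<eta> (\<zeta> \<eta>) = 0) \<and>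
       normal_form_sign k s \<and> (\<forall>j\<le>k + 1. a j 0 = 0) \<and>
       (\<forall>\<^sub>F \<eta> in nhds 0.
          (\<lambda>z. \<Phi> \<eta> (f \<eta> z) - (cnj (\<Phi> \<eta> z) + (\<Sum>j\<le>k + 1. a j \<eta> * cnj (\<Phi> \<eta> z) ^ j)
                              + s / 2 * cnj (\<Phi> \<eta> z) ^ (k + 1)))
            \<in> o[at (\<zeta> \<eta>)](\<lambda>z. cnj (\<Phi> \<eta> z) ^ (k + 1))) \<and>
       bij_betw e (Basis :: 'p set) {..<k} \<and>
       local_diffeomorphism_at (\<lambda>\<eta>. \<Sum>b\<in>Basis. Re (a (e b) \<eta>) *\<^sub>R b) 0))"

section \<open>The multicorn family\<close>

definition multicorn :: "nat \<Rightarrow> complex \<Rightarrow> complex \<Rightarrow> complex"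
  where "multicorn d c z = cnj z ^ d + c"

definition c_tau :: "nat \<Rightarrow> complex \<Rightarrow> complex"
  where "c_tau d \<tau> =
    of_real ((real d + 1) * real d powr (- (real d / (real d - 1)))) * cis (pi / (real d + 1)) * \<tau>"

definition z_tau :: "nat \<Rightarrow> complex \<Rightarrow> complex"
  where "z_tau d \<tau> =
    of_real (real d powr (- (1 / (real d - 1)))) * cis (pi / (real d + 1)) * \<tau>"

end

theory Submission
  imports Defs
begin

text \<open>At a fixed point \<open>z0\<close> with multiplier \<open>\<mu>\<^sup>2\<close>, where \<open>norm \<mu> = 1\<close>, put \<open>w = (z - z0) / \<mu>\<close>. The
  map becomes \<open>cnj w + A * cnj w ^ 2 + B * cnj w ^ 3 + \<dots>\<close> with \<open>A = (d - 1) / 2 * \<rho>\<close>,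
  \<open>B = (d - 1) * (d - 2) / 6 * \<rho>\<^sup>2\<close> and \<open>\<rho> = cnj (\<mu> / z0)\<close>. The change of coordinate
  \<open>w + \<alpha> * w\<^sup>2\<close> with imaginary \<open>\<alpha>\<close> kills \<open>Im A\<close> but cannot change \<open>Re A\<close>, so the codimension is
  1 unless \<open>\<rho>\<close> is imaginary, which happens exactly at the points \<open>z_tau\<close>. There the cubic
  coefficient is \<open>B - A\<^sup>2\<close>, a positive number, so the codimension is 2.

  The same coordinate, not moving with the parameter, works for the unfolding: replacing \<open>c\<close> by
  \<open>c + \<mu> * \<delta>\<close> gives \<open>a\<^sub>0 = t * (\<delta> + \<alpha> * \<delta>\<^sup>2)\<close> and \<open>a\<^sub>1 = 2 * \<alpha> * \<delta>\<close>, whose real parts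
  depend to first order on \<open>Re \<delta>\<close> and \<open>Im \<delta>\<close> respectively.\<close>

section \<open>Real-analyticity and smoothness criteria\<close>

text \<open>Finite sums of monomials in the coordinates of \<open>x - x0\<close>. Every map whose
  real-analyticity is at stake is of this kind, so no convergence estimate arises and membership
  follows from closure rules.\<close>

inductive polynomial_map :: "'a::euclidean_space \<Rightarrow> ('a \<Rightarrow> 'b::real_normed_algebra_1) \<Rightarrow> bool"
  for x0 where
  monomial: "\<alpha> \<in> Basis \<rightarrow>\<^sub>E UNIV \<Longrightarrow>
    polynomial_map x0 (\<lambda>x. (\<Prod>b\<in>Basis. ((x - x0) \<bullet> b) ^ \<alpha> b) *\<^sub>R v)"
| add: "polynomial_map x0 f \<Longrightarrow> polynomial_map x0 g \<Longrightarrow> polynomial_map x0 (\<lambda>x. f x + g x)"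

lemma polynomial_map_const: "polynomial_map x0 (\<lambda>x. v)"
proof -
  \<comment> \<open>Multi-indices are extensional functions on \<open>Basis\<close>, hence the
    \<open>restrict\<close>.\<close>
  have "polynomial_map x0 (\<lambda>x. (\<Prod>b\<in>Basis. ((x - x0) \<bullet> b) ^ restrict (\<lambda>_. 0) Basis b) *\<^sub>R v)"
    by (rule polynomial_map.monomial) auto
  then show ?thesis by simp
qed

lemma polynomial_map_sum:
  assumes "finite S" "\<And>i. i \<in> S \<Longrightarrow> polynomial_map x0 (f i)"
  shows "polynomial_map x0 (\<lambda>x. \<Sum>i\<in>S. f i x)"
  using assms by (induction S rule: finite_induct)
    (auto intro: polynomial_map_const polynomial_map.add)

text \<open>Linearity gives \<open>f x = f x0 + (\<Sum>b\<in>Basis. ((x - x0) \<bullet> b) *\<^sub>R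
  f b)\<close>: a constant plus monomials of degree one.\<close>

lemma polynomial_map_bounded_linear:
  assumes "bounded_linear f"
  shows "polynomial_map x0 f"
proof -
  interpret bounded_linear f by fact
  have "polynomial_map x0 (\<lambda>x. ((x - x0) \<bullet> b) *\<^sub>R f b)" if b: "b \<in> Basis" for b
  proof -
    have "(\<Prod>i\<in>Basis. ((x - x0) \<bullet> i) ^ restrict (\<lambda>i. if i = b then 1 else 0) Basis i) =
        (\<Prod>i\<in>Basis. if i = b then (x - x0) \<bullet> b else 1)" for x
      by (rule prod.cong) auto
    then have eq: "(\<Prod>i\<in>Basis. ((x - x0) \<bullet> i) ^ restrict (\<lambda>i. if i = b then 1 else 0) Basis i) =
        (x - x0) \<bullet> b" for x
      using b by simp
    have "polynomial_map x0 (\<lambda>x. (\<Prod>i\<in>Basis. ((x - x0) \<bullet> i) ^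
        restrict (\<lambda>i. if i = b then 1 else 0) Basis i) *\<^sub>R f b)"
      by (rule polynomial_map.monomial) auto
    then show ?thesis unfolding eq .
  qed
  then have "polynomial_map x0 (\<lambda>x. f x0 + (\<Sum>b\<in>Basis. ((x - x0) \<bullet> b) *\<^sub>R f b))"
    by (intro polynomial_map.add polynomial_map_sum polynomial_map_const) auto
  also have "(\<lambda>x. f x0 + (\<Sum>b\<in>Basis. ((x - x0) \<bullet> b) *\<^sub>R f b)) = f"
  proof
    fix x
    have "(\<Sum>b\<in>Basis. ((x - x0) \<bullet> b) *\<^sub>R f b) = f (\<Sum>b\<in>Basis. ((x - x0) \<bullet> b) *\<^sub>R b)"
      by (simp add: sum scaleR)
    also have "\<dots> = f x - f x0"
      by (simp add: euclidean_representation diff)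
    finally show "f x0 + (\<Sum>b\<in>Basis. ((x - x0) \<bullet> b) *\<^sub>R f b) = f x"
      by simp
  qed
  finally show ?thesis .
qed

text \<open>By distributivity in each factor only a product of two monomials matters; there the
  multi-indices add.\<close>

lemma polynomial_map_mult:
  assumes "polynomial_map x0 f" "polynomial_map x0 g"
  shows "polynomial_map x0 (\<lambda>x. f x * g x)"
  using assms(1)
proof (induction rule: polynomial_map.induct)
  case (monomial \<alpha> v)
  show ?case
    using assms(2)
  proof (induction rule: polynomial_map.induct)
    case (monomial \<beta> w)
    have "polynomial_map x0 (\<lambda>x. (\<Prod>b\<in>Basis. ((x - x0) \<bullet> b) ^
        restrict (\<lambda>b. \<beta> b + \<alpha> b) Basis b) *\<^sub>R (v * w))"
      by (rule polynomial_map.monomial) auto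
    then show ?case
      by (simp add: power_add prod.distrib)
  next
    case (add f g)
    show ?case
      unfolding distrib_left by (rule polynomial_map.add add.IH)+
  qed
next
  case (add f g)
  show ?case
    unfolding distrib_right by (rule polynomial_map.add add.IH)+
qed

lemma polynomial_map_power:
  "polynomial_map x0 f \<Longrightarrow> polynomial_map x0 (\<lambda>x. f x ^ n)"
  by (induction n) (auto intro: polynomial_map_const polynomial_map_mult)

text \<open>A monomial has a coefficient family supported at one multi-index, and families add along
  sums. The expansion holds at every \<open>x\<close>, not only near \<open>x0\<close>.\<close>

lemma polynomial_map_real_analytic_at:
  assumes "polynomial_map x0 f"
  shows "real_analytic_at f x0"
proof -
  let ?m = "\<lambda>\<alpha> x. \<Prod>b\<in>Basis. ((x - x0) \<bullet> b) ^ \<alpha> b"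
  from assms have "\<exists>C. \<forall>x. ((\<lambda>\<alpha>. ?m \<alpha> x *\<^sub>R C \<alpha>) has_sum f x) (Basis \<rightarrow>\<^sub>E UNIV)"
  proof (induction rule: polynomial_map.induct)
    case (monomial \<alpha> v)
    have "((\<lambda>\<beta>. ?m \<beta> x *\<^sub>R (if \<beta> = \<alpha> then v else 0)) has_sum ?m \<alpha> x *\<^sub>R v) (Basis \<rightarrow>\<^sub>E UNIV)" for x
      by (rule has_sum_finite_neutralI[where B = "{\<alpha>}"]) (use monomial in auto)
    then show ?case by (intro exI allI)
  next
    case (add f g)
    then obtain C D where
      C: "\<And>x. ((\<lambda>\<alpha>. ?m \<alpha> x *\<^sub>R C \<alpha>) has_sum f x) (Basis \<rightarrow>\<^sub>E UNIV)" and
      D: "\<And>x. ((\<lambda>\<alpha>. ?m \<alpha> x *\<^sub>R D \<alpha>) has_sum g x) (Basis \<rightarrow>\<^sub>E UNIV)"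
      by blast
    have "((\<lambda>\<alpha>. ?m \<alpha> x *\<^sub>R (C \<alpha> + D \<alpha>)) has_sum f x + g x) (Basis \<rightarrow>\<^sub>E UNIV)" for x
      unfolding scaleR_right_distrib by (rule has_sum_add[OF C D])
    then show ?case by (intro exI[of _ "\<lambda>\<alpha>. C \<alpha> + D \<alpha>"]) auto
  qed
  then show ?thesis
    unfolding real_analytic_at_def by (metis (no_types, lifting) always_eventually)
qed

text \<open>In finite dimensions, continuity of the derivative as an operator can be checked on
  basis vectors.\<close>

lemma C1_onI:
  assumes "\<And>x. x \<in> U \<Longrightarrow> (f has_derivative D x) (at x)"
    and "\<And>b. b \<in> Basis \<Longrightarrow> continuous_on U (\<lambda>x. D x b)"
  shows "C1_on f U"
  unfolding C1_on_def
proof (intro exI conjI ballI)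
  have D: "blinfun_apply (Blinfun (D x)) = D x" if "x \<in> U" for x
    using assms(1)[OF that] by (intro bounded_linear_Blinfun_apply has_derivative_bounded_linear)
  show "(f has_derivative blinfun_apply (Blinfun (D x))) (at x)" if "x \<in> U" for x
    using assms(1) D that by simp
  show "continuous_on U (\<lambda>x. Blinfun (D x))"
    by (rule continuous_on_blinfun_componentwise) (use assms(2) D in \<open>simp cong: continuous_on_cong\<close>)
qed

section \<open>Parabolic points of the multicorn family\<close>

text \<open>Locally \<open>f w = g w * (w - z) ^ n\<close> with \<open>g z \<noteq> 0\<close> and
  \<open>n \<ge> 1\<close>. If \<open>n = 1\<close>, the derivative at \<open>z\<close> is
  \<open>g z\<close>, hence nonzero; conversely, a nonzero derivative forces order 1.\<close>

lemma zorder_ge_2_iff_deriv_eq_0: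
  assumes f: "f analytic_on {z}" "f z = 0" and nz: "\<exists>\<^sub>F w in at z. f w \<noteq> 0"
  shows "zorder f z \<ge> 2 \<longleftrightarrow> deriv f z = 0"
proof
  assume "zorder f z \<ge> 2"
  moreover have "zorder f z = 1" if "deriv f z \<noteq> 0"
    by (rule zorder_zero_eqI') (use that f in auto)
  ultimately show "deriv f z = 0" by fastforce
next
  assume d: "deriv f z = 0"
  obtain r where r: "r > 0" "f holomorphic_on ball z r"
    using f(1) unfolding analytic_at_ball by auto
  have "\<exists>w\<in>ball z r. f w \<noteq> 0"
  proof -
    have "\<forall>\<^sub>F w in at z. w \<in> ball z r"
      using r(1) by (intro eventually_at_in_open') auto
    with nz have "\<exists>\<^sub>F w in at z. f w \<noteq> 0 \<and> w \<in> ball z r"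
      by (rule frequently_eventually_frequently)
    then show ?thesis
      using frequently_ex by blast
  qed
  from zorder_exist_zero[OF r(2) open_ball connected_ball _ this, of z] f(2) r(1)
  obtain s where pos: "zorder f z > 0" and s: "s > 0" "zor_poly f z holomorphic_on cball z s"
    "\<And>w. w \<in> cball z s \<Longrightarrow> f w = zor_poly f z w * (w - z) ^ nat (zorder f z)"
    "\<And>w. w \<in> cball z s \<Longrightarrow> zor_poly f z w \<noteq> 0"
    by auto
  show "zorder f z \<ge> 2"
  proof (rule ccontr)
    assume "\<not> zorder f z \<ge> 2"
    with pos have 1: "zorder f z = 1" by linarith
    let ?g = "zor_poly f z"
    have "(?g has_field_derivative deriv ?g z) (at z)"
      by (rule holomorphic_derivI[of _ "ball z s"])
        (use s in \<open>auto intro: holomorphic_on_subset\<close>)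
    then have g: "((\<lambda>w. ?g w * (w - z)) has_field_derivative ?g z) (at z)"
      by (auto intro!: derivative_eq_intros)
    have "\<forall>\<^sub>F w in nhds z. w \<in> ball z s"
      using s(1) by (intro eventually_nhds_in_open) auto
    then have eq: "\<forall>\<^sub>F w in nhds z. ?g w * (w - z) = f w"
      by eventually_elim (use s(3) 1 in auto)
    have "(f has_field_derivative ?g z) (at z)"
      using DERIV_cong_ev[OF refl eq refl] g by (rule iffD1)
    with d have "?g z = 0"
      by (simp add: DERIV_imp_deriv)
    with s(1) s(4)[of z] show False by simp
  qed
qed

lemma multicorn_twice:
  "multicorn d c (multicorn d c z) = (z ^ d + cnj c) ^ d + c"
  by (simp add: multicorn_def)

text \<open>The second iterate minus the identity is a polynomial in \<open>z\<close> of degree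
  \<open>d * d\<close>, which exceeds 1, so it has finitely many zeros.\<close>

lemma frequently_multicorn_twice_neq:
  assumes "d \<ge> 2"
  shows "\<exists>\<^sub>F z in at z0. multicorn d c (multicorn d c z) \<noteq> z"
proof -
  define q where "q = (monom 1 d + [:cnj c:]) ^ d"
  define p where "p = q + [:c, -1:]"
  have "degree (monom 1 d + [:cnj c:]) = d"
    using assms by (subst degree_add_eq_left) (auto simp: degree_monom_eq)
  then have q: "degree q = d * d"
    unfolding q_def using assms by (subst degree_power_eq) auto
  have "degree p = d * d"
    unfolding p_def using assms
    by (subst degree_add_eq_left) (auto simp: q intro: less_le_trans[of _ "2 * 2"] mult_mono)
  then have "p \<noteq> 0" using assms by auto
  then have "finite {z. poly p z = 0}"
    by (rule poly_roots_finite)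
  then have "\<forall>\<^sub>F z in at z0. \<not> poly p z = 0"
    using islimpt_finite[of "{z. poly p z = 0}" z0] by (simp add: islimpt_iff_eventually)
  then have "\<forall>\<^sub>F z in at z0. multicorn d c (multicorn d c z) \<noteq> z"
    by eventually_elim
      (auto simp: p_def q_def multicorn_twice poly_monom algebra_simps)
  then show ?thesis
    by (rule eventually_frequently[rotated]) simp
qed

lemma antiholomorphic_at_multicorn: "antiholomorphic_at (multicorn d c) z"
  by (auto simp: antiholomorphic_at_def multicorn_def intro!: analytic_intros)

text \<open>At a fixed point the second iterate has derivative
  \<open>norm (d * cnj z ^ (d - 1)) ^ 2\<close>, and multiplicity at least 2 means that this equals
  1.\<close>

lemma parabolic_fixed_point_multicorn_iff:
  assumes "d \<ge> 2"
  shows "parabolic_fixed_point (multicorn d c) z \<longleftrightarrow>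
    cnj z ^ d + c = z \<and> norm (d * cnj z ^ (d - 1)) = 1"
proof (cases "cnj z ^ d + c = z")
  case True
  then have z: "z ^ d + cnj c = cnj z"
    by (metis complex_cnj_add complex_cnj_cnj complex_cnj_power)
  let ?f = "\<lambda>w. multicorn d c (multicorn d c w) - w"
  have "(?f has_field_derivative
      d * (z ^ d + cnj c) ^ (d - 1) * (d * z ^ (d - 1)) - 1) (at z)"
    unfolding multicorn_twice by (auto intro!: derivative_eq_intros)
  then have "deriv ?f z = (d * cnj z ^ (d - 1)) * cnj (d * cnj z ^ (d - 1)) - 1"
    by (simp add: DERIV_imp_deriv z)
  also have "\<dots> = of_real (norm (d * cnj z ^ (d - 1)) ^ 2 - 1)"
    by (simp only: complex_norm_square of_real_diff of_real_1)
  finally have "deriv ?f z = 0 \<longleftrightarrow> norm (d * cnj z ^ (d - 1)) ^ 2 = 1"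
    by (simp only: of_real_eq_0_iff) simp
  also have "\<dots> \<longleftrightarrow> norm (d * cnj z ^ (d - 1)) = 1"
    by (simp only: power2_eq_1_iff) (smt (verit) norm_ge_zero)
  finally have der: "deriv ?f z = 0 \<longleftrightarrow> norm (d * cnj z ^ (d - 1)) = 1" .
  have "?f analytic_on {z}"
    unfolding multicorn_twice by (intro analytic_intros)
  moreover have "?f z = 0"
    using True by (simp add: multicorn_def)
  moreover have fr: "\<exists>\<^sub>F w in at z. ?f w \<noteq> 0"
    using frequently_multicorn_twice_neq[OF assms] by simp
  ultimately have "zorder ?f z \<ge> 2 \<longleftrightarrow> norm (d * cnj z ^ (d - 1)) = 1"
    unfolding der[symmetric] by (rule zorder_ge_2_iff_deriv_eq_0)
  with True frequently_multicorn_twice_neq[OF assms] show ?thesis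
    unfolding parabolic_fixed_point_def
    by (simp add: antiholomorphic_at_multicorn) (simp add: multicorn_def)
qed (auto simp: parabolic_fixed_point_def multicorn_def)

section \<open>Expansion in the normalizing coordinate\<close>

text \<open>If \<open>\<mu>\<^sup>2\<close> is the derivative with respect to \<open>cnj z\<close>, the rotation by \<open>\<mu>\<close> turns the linear
  part of the map into \<open>cnj\<close>.\<close>

definition coord :: "complex \<Rightarrow> complex \<Rightarrow> real \<Rightarrow> complex \<Rightarrow> complex \<Rightarrow> complex"
  where "coord z0 \<mu> t \<alpha> z = of_real t * ((z - z0) / \<mu> + \<alpha> * ((z - z0) / \<mu>) ^ 2)"

text \<open>The coefficient of \<open>cnj (coord z) ^ j\<close>, for \<open>j \<le> 3\<close>, of a map that reads
  \<open>\<delta> + cnj w + A * cnj w ^ 2 + B * cnj w ^ 3 + \<dots>\<close> in \<open>w = (z - z0) / \<mu>\<close>.\<close>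

definition unfolding_coeff ::
    "complex \<Rightarrow> complex \<Rightarrow> complex \<Rightarrow> real \<Rightarrow> complex \<Rightarrow> nat \<Rightarrow> complex"
  where "unfolding_coeff A B \<alpha> t \<delta> j =
    (let u = 1 + 2 * \<alpha> * \<delta>; v = u * (A - cnj \<alpha>) + \<alpha> in
     if j = 0 then of_real t * (\<delta> + \<alpha> * \<delta> ^ 2)
     else if j = 1 then u
     else if j = 2 then v / of_real t
     else (u * B + 2 * \<alpha> * A - 2 * cnj \<alpha> * v) / of_real t ^ 2)"

text \<open>The remainder is kept as an exact multiple of \<open>x ^ 4\<close>, so that later
  coordinate changes are algebraic identities and limits are taken only at the end.\<close>

lemma power_add_expansion_4:
  fixes a m :: complex
  obtains H where "continuous_on UNIV H"
    "\<And>x. (a + m * x) ^ d = a ^ d + of_nat d * a ^ (d - 1) * m * x +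
        of_nat (d choose 2) * a ^ (d - 2) * m ^ 2 * x ^ 2 +
        of_nat (d choose 3) * a ^ (d - 3) * m ^ 3 * x ^ 3 + x ^ 4 * H x"
proof
  let ?g = "\<lambda>k. of_nat (d choose k) * a ^ (d - k) * m ^ k"
  let ?H = "\<lambda>x. \<Sum>k<d. ?g (4 + k) * x ^ k"
  show "continuous_on UNIV ?H"
    by (intro continuous_intros)
  show "(a + m * x) ^ d = a ^ d + of_nat d * a ^ (d - 1) * m * x +
        of_nat (d choose 2) * a ^ (d - 2) * m ^ 2 * x ^ 2 +
        of_nat (d choose 3) * a ^ (d - 3) * m ^ 3 * x ^ 3 + x ^ 4 * ?H x" for x
  proof -
    have split: "(\<Sum>k<4 + n. h k) = (\<Sum>k<4. h k) + (\<Sum>k<n. h (4 + k))"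
      for h :: "nat \<Rightarrow> complex" and n
      by (induction n) (simp, simp only: add_Suc_right sum.lessThan_Suc add.assoc)
    have "(a + m * x) ^ d = (\<Sum>k\<le>d. ?g k * x ^ k)"
      unfolding add.commute[of a] binomial_ring
      by (simp add: power_mult_distrib mult_ac)
    \<comment> \<open>The added binomial coefficients vanish; the longer range can be split at 4
      even when \<open>d < 4\<close>.\<close>
    also have "\<dots> = (\<Sum>k<4 + d. ?g k * x ^ k)"
      by (rule sum.mono_neutral_left) (auto simp: binomial_eq_0)
    also have "\<dots> = (\<Sum>k<4. ?g k * x ^ k) + (\<Sum>k<d. ?g (4 + k) * x ^ (4 + k))"
      by (rule split)
    also have "(\<Sum>k<d. ?g (4 + k) * x ^ (4 + k)) = x ^ 4 * ?H x"
      by (simp add: sum_distrib_left power_add mult_ac)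
    also have "(\<Sum>k<4. ?g k * x ^ k) = a ^ d + of_nat d * a ^ (d - 1) * m * x +
        of_nat (d choose 2) * a ^ (d - 2) * m ^ 2 * x ^ 2 +
        of_nat (d choose 3) * a ^ (d - 3) * m ^ 3 * x ^ 3"
      by (simp add: numeral_eq_Suc)
    finally show ?thesis .
  qed
qed

text \<open>With \<open>x = cnj w\<close> and \<open>\<beta> = cnj \<alpha>\<close>,
  \<open>y\<close> is the conjugate of \<open>w + \<alpha> * w ^ 2\<close>, and the left side is the
  new coordinate of the image \<open>F + \<delta>\<close>, up to the scale \<open>t\<close>.
  Matching powers of \<open>y\<close> yields \<open>u\<close>, \<open>v\<close>, \<open>s\<close>;
  the last bracket collects everything of order at least 4, using
  \<open>F = x + x ^ 2 * E\<close>.\<close>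

lemma expansion_identity:
  fixes x A B \<alpha> \<beta> \<delta> h :: complex
  defines "F \<equiv> x + A * x ^ 2 + B * x ^ 3 + x ^ 4 * h"
  defines "y \<equiv> x + \<beta> * x ^ 2" and "u \<equiv> 1 + 2 * \<alpha> * \<delta>"
  defines "v \<equiv> u * (A - \<beta>) + \<alpha>"
  defines "s \<equiv> u * B + 2 * \<alpha> * A - 2 * \<beta> * v" and "E \<equiv> A + B * x + x ^ 2 * h"
  shows "(F + \<delta>) + \<alpha> * (F + \<delta>) ^ 2 =
    (\<delta> + \<alpha> * \<delta> ^ 2) + u * y + v * y ^ 2 + s * y ^ 3 +
    x ^ 4 * (u * h + \<alpha> * (2 * B + 2 * x * h + E ^ 2) - v * \<beta> ^ 2
      - s * (3 * \<beta> + 3 * \<beta> ^ 2 * x + \<beta> ^ 3 * x ^ 2))"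
proof -
  have "y ^ 2 = x ^ 2 + 2 * \<beta> * x ^ 3 + \<beta> ^ 2 * x ^ 4"
    unfolding y_def by algebra
  moreover have "y ^ 3 = x ^ 3 + x ^ 4 * (3 * \<beta> + 3 * \<beta> ^ 2 * x + \<beta> ^ 3 * x ^ 2)"
    unfolding y_def by algebra
  moreover have "F ^ 2 = x ^ 2 + 2 * A * x ^ 3 + x ^ 4 * (2 * B + 2 * x * h + E ^ 2)"
    unfolding F_def E_def by algebra
  moreover have "(F + \<delta>) + \<alpha> * (F + \<delta>) ^ 2 = (\<delta> + \<alpha> * \<delta> ^ 2) + u * F + \<alpha> * F ^ 2"
    unfolding u_def by algebra
  ultimately show ?thesis
    unfolding s_def v_def F_def y_def by algebra
qed

text \<open>The choice of \<open>\<mu>\<close> makes the linear coefficient 1. Each further power of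
  \<open>x\<close> contributes a factor \<open>cnj \<mu> / cnj z0 = \<rho>\<close>, so the
  coefficient of \<open>x ^ k\<close> is \<open>(d choose k) / d * \<rho> ^ (k - 1)\<close>.\<close>

lemma multicorn_expansion:
  assumes "d \<ge> 2" "z0 \<noteq> 0" "norm \<mu> = 1" "\<mu> ^ 2 = of_nat d * cnj z0 ^ (d - 1)"
  defines "\<rho> \<equiv> cnj (\<mu> / z0)"
  obtains H where "continuous_on UNIV H"
    "\<And>x. ((cnj z0 + cnj \<mu> * x) ^ d - cnj z0 ^ d) / \<mu> =
       x + ((of_nat d - 1) / 2 * \<rho>) * x ^ 2 +
       ((of_nat d - 1) * (of_nat d - 2) / 6 * \<rho> ^ 2) * x ^ 3 + x ^ 4 * H x"
proof -
  define a where "a = cnj z0"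
  define n where "n = (of_nat d :: complex)"
  have a: "a \<noteq> 0" and mu: "\<mu> \<noteq> 0"
    using assms by (auto simp: a_def)
  have cmu: "cnj \<mu> = 1 / \<mu>"
    using assms(3) mu by (simp add: field_simps complex_norm_square[symmetric])
  have rho: "\<rho> = 1 / (\<mu> * a)"
    by (simp add: \<rho>_def cmu a_def)
  have mu2: "\<mu> ^ 2 = n * a ^ (d - 1)"
    using assms(4) by (simp add: a_def n_def)
  obtain H where H: "continuous_on UNIV H"
    "\<And>x. (a + cnj \<mu> * x) ^ d = a ^ d + of_nat d * a ^ (d - 1) * cnj \<mu> * x +
        of_nat (d choose 2) * a ^ (d - 2) * cnj \<mu> ^ 2 * x ^ 2 +
        of_nat (d choose 3) * a ^ (d - 3) * cnj \<mu> ^ 3 * x ^ 3 + x ^ 4 * H x"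
    using power_add_expansion_4[where a = a and m = "cnj \<mu>" and d = d] by blast
  have c1: "of_nat d * a ^ (d - 1) * cnj \<mu> = \<mu>"
  proof -
    have "of_nat d * a ^ (d - 1) * cnj \<mu> = \<mu> ^ 2 * cnj \<mu>"
      by (simp only: mu2 n_def)
    then show ?thesis
      using mu by (simp add: cmu power2_eq_square)
  qed
  have "of_nat (d choose 2) = n * (n - 1) / 2"
    by (simp add: binomial_gbinomial gbinomial_prod_rev n_def numeral_2_eq_2 field_simps)
  moreover have "n * a ^ (d - 2) = \<mu> ^ 2 / a"
  proof -
    have "a ^ (d - 1) = a * a ^ (d - 2)"
      using assms(1) by (simp add: Suc_diff_Suc numeral_2_eq_2 flip: power_Suc)
    then show ?thesis
      using a by (simp add: mu2)
  qed
  ultimately have eq2: "of_nat (d choose 2) * a ^ (d - 2) = (n - 1) / 2 * (\<mu> ^ 2 / a)"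
    by (metis (no_types, lifting) mult.assoc mult.commute times_divide_eq_left)
  have c2: "of_nat (d choose 2) * a ^ (d - 2) * cnj \<mu> ^ 2 = \<mu> * ((n - 1) / 2 * \<rho>)"
    unfolding eq2 cmu rho using mu a by (simp add: field_simps)
  have c3: "of_nat (d choose 3) * a ^ (d - 3) * cnj \<mu> ^ 3 = \<mu> * ((n - 1) * (n - 2) / 6 * \<rho> ^ 2)"
  \<comment> \<open>For \<open>d = 2\<close> the exponent \<open>d - 3\<close> is truncated, but
    both sides are zero.\<close>
  proof (cases "d = 2")
    case False
    have "of_nat (d choose 3) = n * (n - 1) * (n - 2) / 6"
      by (simp add: binomial_gbinomial gbinomial_prod_rev n_def numeral_3_eq_3 fact_numeral)
    moreover have "n * a ^ (d - 3) = \<mu> ^ 2 / a ^ 2"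
    proof -
      have "d - 1 = 2 + (d - 3)"
        using assms(1) False by simp
      then have "a ^ (d - 1) = a ^ 2 * a ^ (d - 3)"
        by (simp only: power_add)
      then show ?thesis
        using a by (simp add: mu2)
    qed
    ultimately have eq3: "of_nat (d choose 3) * a ^ (d - 3) = (n - 1) * (n - 2) / 6 * (\<mu> ^ 2 / a ^ 2)"
      by (metis (no_types, lifting) mult.assoc mult.commute times_divide_eq_left)
    show ?thesis
      unfolding eq3 cmu rho
      using mu a by (simp add: field_simps power2_eq_square power3_eq_cube)
  qed (simp add: n_def)
  show ?thesis
  proof
    show "continuous_on UNIV (\<lambda>x. H x / \<mu>)"
      using H(1) mu by (intro continuous_intros) auto
    show "((cnj z0 + cnj \<mu> * x) ^ d - cnj z0 ^ d) / \<mu> =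
       x + ((of_nat d - 1) / 2 * \<rho>) * x ^ 2 +
       ((of_nat d - 1) * (of_nat d - 2) / 6 * \<rho> ^ 2) * x ^ 3 + x ^ 4 * (H x / \<mu>)" for x
      unfolding a_def[symmetric] H(2) c1 c2 c3
      using mu by (simp add: n_def[symmetric] field_simps)
  qed
qed

text \<open>The error after the cubic term is \<open>t * X ^ 4 * R X\<close> with \<open>R\<close>
  continuous, while the conjugate coordinate is \<open>t * X\<close> to first order. The expansion
  point stays at \<open>z0\<close> for the perturbed parameter \<open>c + e\<close> too.\<close>

lemma multicorn_coord_smallo:
  fixes \<alpha> e :: complex and k :: nat
  assumes "d \<ge> 2" "z0 \<noteq> 0" "norm \<mu> = 1" "\<mu> ^ 2 = of_nat d * cnj z0 ^ (d - 1)"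
    and "cnj z0 ^ d + c = z0" "t \<noteq> 0" "k = 1 \<or> k = 2"
  defines "\<rho> \<equiv> cnj (\<mu> / z0)"
  defines "b \<equiv> unfolding_coeff ((of_nat d - 1) / 2 * \<rho>)
      ((of_nat d - 1) * (of_nat d - 2) / 6 * \<rho> ^ 2) \<alpha> t (e / \<mu>)"
  shows "(\<lambda>z. coord z0 \<mu> t \<alpha> (multicorn d (c + e) z) -
      (\<Sum>j\<le>k + 1. b j * cnj (coord z0 \<mu> t \<alpha> z) ^ j))
    \<in> o[at z0](\<lambda>z. cnj (coord z0 \<mu> t \<alpha> z) ^ (k + 1))"
proof -
  define A where "A = (of_nat d - 1) / 2 * \<rho>"
  define B where "B = (of_nat d - 1) * (of_nat d - 2) / 6 * \<rho> ^ 2"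
  have mu: "\<mu> \<noteq> 0"
    using assms(3) by auto
  have cmu: "cnj \<mu> = 1 / \<mu>"
    using assms(3) mu by (simp add: field_simps complex_norm_square[symmetric])
  obtain H where H: "continuous_on UNIV H"
    "\<And>x. ((cnj z0 + cnj \<mu> * x) ^ d - cnj z0 ^ d) / \<mu> = x + A * x ^ 2 + B * x ^ 3 + x ^ 4 * H x"
    using multicorn_expansion[OF assms(1-4)] unfolding A_def B_def \<rho>_def by metis
  define u where "u = 1 + 2 * \<alpha> * (e / \<mu>)"
  define v where "v = u * (A - cnj \<alpha>) + \<alpha>"
  define s where "s = u * B + 2 * \<alpha> * A - 2 * cnj \<alpha> * v"
  \<comment> \<open>The order-4 bracket of \<open>expansion_identity\<close> at
    \<open>\<beta> = cnj \<alpha>\<close>.\<close>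
  define R where "R x = u * H x +
      \<alpha> * (2 * B + 2 * x * H x + (A + B * x + x ^ 2 * H x) ^ 2) - v * cnj \<alpha> ^ 2 -
      s * (3 * cnj \<alpha> + 3 * cnj \<alpha> ^ 2 * x + cnj \<alpha> ^ 3 * x ^ 2)" for x
  define X where "X z = cnj ((z - z0) / \<mu>)" for z
  define g where "g z = cnj (coord z0 \<mu> t \<alpha> z)" for z
  define L where "L z = coord z0 \<mu> t \<alpha> (multicorn d (c + e) z)" for z
  have g: "g z = of_real t * (X z + cnj \<alpha> * X z ^ 2)" for z
    by (simp add: g_def coord_def X_def)
  have L: "L z = (\<Sum>j\<le>3. b j * g z ^ j) + of_real t * X z ^ 4 * R (X z)" for z
  proof -
    have "cnj z = cnj z0 + cnj \<mu> * X z"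
      using mu by (simp add: X_def)
    then have "(multicorn d (c + e) z - z0) / \<mu> =
        ((cnj z0 + cnj \<mu> * X z) ^ d - cnj z0 ^ d) / \<mu> + e / \<mu>"
      using mu assms(5) by (simp add: multicorn_def field_simps)
    also have "((cnj z0 + cnj \<mu> * X z) ^ d - cnj z0 ^ d) / \<mu> =
        X z + A * X z ^ 2 + B * X z ^ 3 + X z ^ 4 * H (X z)"
      by (rule H(2))
    finally have "L z = of_real t * ((e / \<mu> + \<alpha> * (e / \<mu>) ^ 2) + u * (X z + cnj \<alpha> * X z ^ 2) +
        v * (X z + cnj \<alpha> * X z ^ 2) ^ 2 + s * (X z + cnj \<alpha> * X z ^ 2) ^ 3 + X z ^ 4 * R (X z))"
      unfolding L_def coord_def R_def u_def v_def s_def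
      by (simp only: expansion_identity[where \<beta> = "cnj \<alpha>"])
    also have "\<dots> = (\<Sum>j\<le>3. b j * g z ^ j) + of_real t * X z ^ 4 * R (X z)"
      unfolding b_def A_def[symmetric] B_def[symmetric] unfolding_coeff_def Let_def
        u_def[symmetric] v_def[symmetric] s_def[symmetric] g
      using assms(6) by (simp add: numeral_3_eq_3 field_simps power2_eq_square)
    finally show ?thesis .
  qed
  have X0: "(X \<longlongrightarrow> 0) (at z0)"
    unfolding X_def using mu by (auto intro!: tendsto_eq_intros)
  have g0: "(g \<longlongrightarrow> 0) (at z0)"
    unfolding g[abs_def] by (auto intro!: tendsto_eq_intros X0)
  have R0: "((\<lambda>z. R (X z)) \<longlongrightarrow> R 0) (at z0)"
  proof -
    have "continuous_on UNIV R"
      unfolding R_def by (intro continuous_intros H(1))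
    then have "isCont R 0"
      by (simp add: continuous_on_eq_continuous_at)
    then show ?thesis
      using X0 isCont_tendsto_compose by blast
  qed
  have one: "((\<lambda>z. 1 + cnj \<alpha> * X z) \<longlongrightarrow> 1) (at z0)"
    by (auto intro!: tendsto_eq_intros X0)
  have nz: "\<forall>\<^sub>F z in at z0. X z \<noteq> 0 \<and> 1 + cnj \<alpha> * X z \<noteq> 0"
  proof (rule eventually_conj)
    show "\<forall>\<^sub>F z in at z0. X z \<noteq> 0"
      using eventually_neq_at_within[of z0 z0 UNIV]
      by eventually_elim (use mu in \<open>simp add: X_def\<close>)
    show "\<forall>\<^sub>F z in at z0. 1 + cnj \<alpha> * X z \<noteq> 0"
      by (rule tendsto_imp_eventually_ne[OF one]) simp
  qed
  have g_mult: "g z = of_real t * X z * (1 + cnj \<alpha> * X z)" for z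
    by (simp add: g power2_eq_square algebra_simps)
  have gnz: "\<forall>\<^sub>F z in at z0. g z \<noteq> 0"
    using nz by eventually_elim (use assms(6) in \<open>simp add: g_mult\<close>)
  have o3: "(\<lambda>z. L z - (\<Sum>j\<le>3. b j * g z ^ j)) \<in> o[at z0](\<lambda>z. g z ^ 3)"
  proof (rule smalloI_tendsto)
    have "((\<lambda>z. X z * R (X z) / (of_real t ^ 2 * (1 + cnj \<alpha> * X z) ^ 3)) \<longlongrightarrow> 0) (at z0)"
      using assms(6) by (auto intro!: tendsto_eq_intros X0 R0 one)
    moreover have "\<forall>\<^sub>F z in at z0. X z * R (X z) / (of_real t ^ 2 * (1 + cnj \<alpha> * X z) ^ 3) =
        (L z - (\<Sum>j\<le>3. b j * g z ^ j)) / g z ^ 3"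
      using nz
    proof eventually_elim
      case (elim z)
      then show ?case
        unfolding L using assms(6)
        by (simp add: g_mult power_mult_distrib divide_simps) (simp add: eval_nat_numeral)
    qed
    ultimately show "((\<lambda>z. (L z - (\<Sum>j\<le>3. b j * g z ^ j)) / g z ^ 3) \<longlongrightarrow> 0) (at z0)"
      by (rule Lim_transform_eventually)
    show "\<forall>\<^sub>F z in at z0. g z ^ 3 \<noteq> 0"
      using gnz by simp
  qed
  have "(\<lambda>z. L z - (\<Sum>j\<le>k + 1. b j * g z ^ j)) \<in> o[at z0](\<lambda>z. g z ^ (k + 1))"
    using assms(7)
  proof
    \<comment> \<open>The cubic term, present in \<open>o3\<close>, is itself negligible against
      \<open>g z ^ 2\<close>.\<close>
    assume k: "k = 1"
    have g32: "(\<lambda>z. g z ^ 3) \<in> o[at z0](\<lambda>z. g z ^ 2)"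
    proof (rule smalloI_tendsto)
      have "\<forall>\<^sub>F z in at z0. g z = g z ^ 3 / g z ^ 2"
        using gnz by eventually_elim (simp add: eval_nat_numeral)
      with g0 show "((\<lambda>z. g z ^ 3 / g z ^ 2) \<longlongrightarrow> 0) (at z0)"
        by (rule Lim_transform_eventually)
    qed (use gnz in simp)
    have "(\<lambda>z. (L z - (\<Sum>j\<le>3. b j * g z ^ j)) + b 3 * g z ^ 3) \<in> o[at z0](\<lambda>z. g z ^ 2)"
      using g32 by (intro sum_in_smallo landau_o.small.trans[OF o3]) auto
    then show ?thesis
      by (simp add: k eval_nat_numeral algebra_simps)
  next
    assume "k = 2"
    with o3 show ?thesis by simp
  qed
  then show ?thesis
    by (simp only: g_def L_def)
qed

section \<open>Normal forms and unfoldings\<close>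

text \<open>Passes between raw coefficients \<open>b j\<close> and their deviations from the normal
  form, whose coefficients are 1 at \<open>j = 1\<close> and 1/2 at
  \<open>j = k + 1\<close>.\<close>

lemma normal_form_sum:
  fixes w :: complex
  assumes "k \<ge> 1"
  shows "w + (\<Sum>j\<le>k + 1. (b j - of_bool (j = 1) - of_bool (j = k + 1) / 2) * w ^ j) +
    1 / 2 * w ^ (k + 1) = (\<Sum>j\<le>k + 1. b j * w ^ j)"
proof -
  have "(\<Sum>j\<le>k + 1. of_bool (j = 1) * w ^ j) = (\<Sum>j\<le>k + 1. if j = 1 then w else 0)"
    by (rule sum.cong) auto
  moreover have "(\<Sum>j\<le>k + 1. of_bool (j = k + 1) / 2 * w ^ j) =
      (\<Sum>j\<le>k + 1. if j = k + 1 then 1 / 2 * w ^ (k + 1) else 0)"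
    by (rule sum.cong) auto
  ultimately show ?thesis
    by (simp add: left_diff_distrib sum_subtractf del: sum.atMost_Suc)
qed

text \<open>Leaves only the coefficients at \<open>\<delta> = 0\<close> to be computed. The sign is
  \<open>+\<close> in both codimensions.\<close>

lemma parabolic_of_codim_multicorn:
  fixes \<alpha> :: complex and k :: nat
  assumes "d \<ge> 2" "z0 \<noteq> 0" "norm \<mu> = 1" "\<mu> ^ 2 = of_nat d * cnj z0 ^ (d - 1)"
    and "cnj z0 ^ d + c = z0" "t \<noteq> 0" "k = 1 \<or> k = 2"
  defines "\<rho> \<equiv> cnj (\<mu> / z0)"
  defines "b \<equiv> \<lambda>\<delta>. unfolding_coeff ((of_nat d - 1) / 2 * \<rho>)
      ((of_nat d - 1) * (of_nat d - 2) / 6 * \<rho> ^ 2) \<alpha> t \<delta>"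
  assumes b0: "\<And>j. j \<le> k + 1 \<Longrightarrow> b 0 j = of_bool (j = 1) + of_bool (j = k + 1) / 2"
  shows "parabolic_of_codim k (multicorn d c) z0"
  unfolding parabolic_of_codim_def
proof (intro conjI exI)
  let ?\<phi> = "coord z0 \<mu> t \<alpha>"
  have mu: "\<mu> \<noteq> 0"
    using assms(3) by auto
  have "norm (of_nat d * cnj z0 ^ (d - 1)) = norm \<mu> ^ 2"
    by (simp only: assms(4)[symmetric] norm_power)
  then show "parabolic_fixed_point (multicorn d c) z0"
    using assms(3,5) by (simp only: parabolic_fixed_point_multicorn_iff[OF assms(1)]) simp
  show "?\<phi> analytic_on {z0}"
    unfolding coord_def using mu by (intro analytic_intros) auto
  show "?\<phi> z0 = 0"
    by (simp add: coord_def)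
  have "(?\<phi> has_field_derivative of_real t / \<mu>) (at z0)"
    unfolding coord_def using mu by (auto intro!: derivative_eq_intros)
  then show "deriv ?\<phi> z0 \<noteq> 0"
    using mu assms(6) by (simp add: DERIV_imp_deriv)
  show "normal_form_sign k 1"
    by (simp add: normal_form_sign_def)
  have "cnj (?\<phi> z) + 1 / 2 * cnj (?\<phi> z) ^ (k + 1) =
      (\<Sum>j\<le>k + 1. b 0 j * cnj (?\<phi> z) ^ j)" for z
    using normal_form_sum[of k "cnj (?\<phi> z)" "b 0"] assms(7) b0 by (auto simp del: sum.atMost_Suc)
  then show "(\<lambda>z. ?\<phi> (multicorn d c z) - (cnj (?\<phi> z) + 1 / 2 * cnj (?\<phi> z) ^ (k + 1)))
      \<in> o[at z0](\<lambda>z. cnj (?\<phi> z) ^ (k + 1))"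
    using multicorn_coord_smallo[OF assms(1-7), where \<alpha> = \<alpha> and e = 0]
    by (simp only: b_def \<rho>_def add_0_right div_0)
qed

text \<open>As the coordinate is independent of the parameter, \<open>\<Phi>\<close> and
  \<open>\<zeta>\<close> are constant in \<open>\<eta>\<close>. What remains is to compute the
  coefficients at \<open>\<delta> = 0\<close> and to invert an explicit map.\<close>

lemma generic_unfolding_multicorn:
  fixes \<alpha> :: complex and e :: "'p::euclidean_space \<Rightarrow> complex"
  assumes "d \<ge> 2" "z0 \<noteq> 0" "norm \<mu> = 1" "\<mu> ^ 2 = of_nat d * cnj z0 ^ (d - 1)"
    and "cnj z0 ^ d + c = z0" "t \<noteq> 0" "DIM('p) = 1 \<or> DIM('p) = 2"
  defines "\<rho> \<equiv> cnj (\<mu> / z0)"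
  defines "b \<equiv> \<lambda>\<delta>. unfolding_coeff ((of_nat d - 1) / 2 * \<rho>)
      ((of_nat d - 1) * (of_nat d - 2) / 6 * \<rho> ^ 2) \<alpha> t \<delta>"
  assumes b0: "\<And>j. j \<le> DIM('p) + 1 \<Longrightarrow> b 0 j = of_bool (j = 1) + of_bool (j = DIM('p) + 1) / 2"
    and e: "bounded_linear e"
    and n: "bij_betw n (Basis :: 'p set) {..<DIM('p)}"
    and diffeo: "local_diffeomorphism_at
      (\<lambda>\<eta>. \<Sum>i\<in>Basis. Re (b (e \<eta> / \<mu>) (n i) - of_bool (n i = 1)) *\<^sub>R i) (0 :: 'p)"
  shows "generic_unfolding (\<lambda>\<eta>. multicorn d (c + e \<eta>)) z0"
proof -
  let ?\<phi> = "coord z0 \<mu> t \<alpha>"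
  define a where "a j \<eta> = b (e \<eta> / \<mu>) j - of_bool (j = 1) - of_bool (j = DIM('p) + 1) / 2"
    for j and \<eta> :: 'p
  have mu: "\<mu> \<noteq> 0"
    using assms(3) by auto
  have e0: "e 0 = 0"
    using e by (simp add: linear_0 bounded_linear.linear)
  have poly: "polynomial_map x0 (\<lambda>x :: 'p \<times> complex. snd x ^ m)" for x0 m
    by (intro polynomial_map_power polynomial_map_bounded_linear bounded_linear_snd)
  have "polynomial_map (0, z0) (\<lambda>x :: 'p \<times> complex. snd x ^ d + (cnj c + cnj (e (fst x))))"
    by (intro polynomial_map.add poly polynomial_map_const polynomial_map_bounded_linear
        bounded_linear_compose[OF bounded_linear_cnj]
        bounded_linear_compose[OF e] bounded_linear_fst)
  then have f: "holomorphic_family_at (\<lambda>\<eta> z. cnj (multicorn d (c + e \<eta>) z)) z0"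
    unfolding holomorphic_family_at_def
    by (auto simp: multicorn_def case_prod_unfold
        dest!: polynomial_map_real_analytic_at intro!: exI[of _ 1] holomorphic_intros)
  have hol: "?\<phi> holomorphic_on S" for S
    unfolding coord_def using mu by (intro holomorphic_intros) auto
  have "polynomial_map (0, z0) (\<lambda>x :: 'p \<times> complex. of_real t *
      ((snd x + (- z0)) * (1 / \<mu>) + \<alpha> * ((snd x + (- z0)) * (1 / \<mu>)) ^ 2))"
    by (intro polynomial_map.add polynomial_map_mult polynomial_map_power
        polynomial_map_const polynomial_map_bounded_linear bounded_linear_snd)
  then have \<Phi>: "holomorphic_family_at (\<lambda>\<eta> :: 'p. ?\<phi>) z0"
    unfolding holomorphic_family_at_def
    using hol by (auto simp: coord_def case_prod_unfold
        dest!: polynomial_map_real_analytic_at intro!: exI[of _ 1])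
  have "(?\<phi> has_field_derivative of_real t / \<mu>) (at z0)"
    unfolding coord_def using mu by (auto intro!: derivative_eq_intros)
  then have deriv: "deriv ?\<phi> z0 \<noteq> 0"
    using mu assms(6) by (simp add: DERIV_imp_deriv)
  \<comment> \<open>The correction at \<open>j = DIM('p) + 1\<close> is absent because
    \<open>n i < DIM('p)\<close>.\<close>
  have a: "(\<lambda>\<eta>. \<Sum>i\<in>Basis. Re (a (n i) \<eta>) *\<^sub>R i) =
      (\<lambda>\<eta>. \<Sum>i\<in>Basis. Re (b (e \<eta> / \<mu>) (n i) - of_bool (n i = 1)) *\<^sub>R i)"
    using bij_betwE[OF n] by (auto simp: a_def fun_eq_iff intro!: sum.cong)
  have "cnj w + (\<Sum>j\<le>DIM('p) + 1. a j \<eta> * cnj w ^ j) + 1 / 2 * cnj w ^ (DIM('p) + 1) =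
      (\<Sum>j\<le>DIM('p) + 1. b (e \<eta> / \<mu>) j * cnj w ^ j)" for w and \<eta> :: 'p
    unfolding a_def using assms(7) by (intro normal_form_sum) auto
  then have smallo: "(\<lambda>z. ?\<phi> (multicorn d (c + e \<eta>) z) -
        (cnj (?\<phi> z) + (\<Sum>j\<le>DIM('p) + 1. a j \<eta> * cnj (?\<phi> z) ^ j) +
          1 / 2 * cnj (?\<phi> z) ^ (DIM('p) + 1)))
      \<in> o[at z0](\<lambda>z. cnj (?\<phi> z) ^ (DIM('p) + 1))" for \<eta> :: 'p
    using multicorn_coord_smallo[OF assms(1-7), where \<alpha> = \<alpha> and e = "e \<eta>"]
    by (simp only: b_def \<rho>_def)
  have codim: "parabolic_of_codim DIM('p) (multicorn d c) z0"
    using b0 unfolding b_def \<rho>_def by (rule parabolic_of_codim_multicorn[OF assms(1-7)])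
  have "\<exists>\<Phi> \<zeta> a s n.
       holomorphic_family_at \<Phi> z0 \<and> deriv (\<Phi> 0) z0 \<noteq> 0 \<and>
       \<zeta> 0 = z0 \<and> isCont \<zeta> 0 \<and> (\<forall>\<^sub>F \<eta> in nhds 0. \<Phi> \<eta> (\<zeta> \<eta>) = 0) \<and>
       normal_form_sign DIM('p) s \<and> (\<forall>j\<le>DIM('p) + 1. a j 0 = 0) \<and>
       (\<forall>\<^sub>F \<eta> in nhds 0.
          (\<lambda>z. \<Phi> \<eta> (multicorn d (c + e \<eta>) z) - (cnj (\<Phi> \<eta> z) +
              (\<Sum>j\<le>DIM('p) + 1. a j \<eta> * cnj (\<Phi> \<eta> z) ^ j) +
              s / 2 * cnj (\<Phi> \<eta> z) ^ (DIM('p) + 1)))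
            \<in> o[at (\<zeta> \<eta>)](\<lambda>z. cnj (\<Phi> \<eta> z) ^ (DIM('p) + 1))) \<and>
       bij_betw n (Basis :: 'p set) {..<DIM('p)} \<and>
       local_diffeomorphism_at (\<lambda>\<eta>. \<Sum>b\<in>Basis. Re (a (n b) \<eta>) *\<^sub>R b) 0"
  proof (rule exI[of _ "\<lambda>_. ?\<phi>"], rule exI[of _ "\<lambda>_. z0"], rule exI[of _ a],
      rule exI[of _ 1], rule exI[of _ n], intro conjI)
    show "\<forall>j\<le>DIM('p) + 1. a j 0 = 0"
      using b0 by (simp add: a_def e0)
    show "\<forall>\<^sub>F \<eta> :: 'p in nhds 0. ?\<phi> z0 = 0"
      by (simp add: coord_def)
    show "normal_form_sign DIM('p) 1"
      by (simp add: normal_form_sign_def)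
    show "local_diffeomorphism_at (\<lambda>\<eta>. \<Sum>b\<in>Basis. Re (a (n b) \<eta>) *\<^sub>R b) (0 :: 'p)"
      unfolding a by (rule diffeo)
    show "\<forall>\<^sub>F \<eta> :: 'p in nhds 0. (\<lambda>z. ?\<phi> (multicorn d (c + e \<eta>) z) -
        (cnj (?\<phi> z) + (\<Sum>j\<le>DIM('p) + 1. a j \<eta> * cnj (?\<phi> z) ^ j) +
          1 / 2 * cnj (?\<phi> z) ^ (DIM('p) + 1)))
      \<in> o[at z0](\<lambda>z. cnj (?\<phi> z) ^ (DIM('p) + 1))"
      by (intro always_eventually allI smallo)
  qed (use \<Phi> deriv n in auto)
  with f codim show ?thesis
    unfolding generic_unfolding_def Let_def by (simp only: e0 add_0_right)
qed

section \<open>Explicit local diffeomorphisms of parameter space\<close>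

lemma local_diffeomorphism_at_real_mult:
  fixes t :: real
  assumes "t \<noteq> 0"
  shows "local_diffeomorphism_at (\<lambda>x. t * x) x0"
  unfolding local_diffeomorphism_at_def
proof (intro exI conjI)
  show "homeomorphism UNIV UNIV (\<lambda>x. t * x) (\<lambda>y. y / t)"
    using assms by (intro homeomorphismI continuous_intros) auto
  show "C1_on (\<lambda>x. t * x) UNIV"
    by (rule C1_onI[where D = "\<lambda>_ h. t * h"])
      (auto intro!: derivative_eq_intros continuous_intros)
  show "C1_on (\<lambda>y. y / t) UNIV"
    using assms by (intro C1_onI[where D = "\<lambda>_ h. h / t"])
      (auto intro!: derivative_eq_intros continuous_intros)
qed auto

text \<open>\<open>(p, q)\<close> is a rotation of the variables. The second component of the image
  determines \<open>q\<close>, and then \<open>1 - 2 * h * q = 1 + snd y\<close> can be divided out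
  of the first to recover \<open>p\<close>; \<open>g\<close> rotates back.\<close>

lemma local_diffeomorphism_at_rotated_shear:
  fixes t h m1 m2 :: real
  assumes "t \<noteq> 0" "h \<noteq> 0" "m1 ^ 2 + m2 ^ 2 = 1"
  defines "p \<equiv> \<lambda>x. m1 * fst x + m2 * snd x" and "q \<equiv> \<lambda>x. m1 * snd x - m2 * fst x"
  shows "local_diffeomorphism_at (\<lambda>x. (t * p x * (1 - 2 * h * q x), - 2 * h * q x)) (0 :: real \<times> real)"
proof -
  define P where "P y = fst y / (t * (1 + snd y))" for y :: "real \<times> real"
  define Q where "Q y = - snd y / (2 * h)" for y :: "real \<times> real"
  define g where "g y = (m1 * P y - m2 * Q y, m2 * P y + m1 * Q y)" for y
  let ?f = "\<lambda>x. (t * p x * (1 - 2 * h * q x), - 2 * h * q x)"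
  \<comment> \<open>Where the divisor is positive, on either side.\<close>
  let ?U = "{x. 0 < 1 - 2 * h * q x}" and ?V = "{y :: real \<times> real. 0 < 1 + snd y}"
  have pq: "m1 * p x - m2 * q x = fst x" "m2 * p x + m1 * q x = snd x" for x
    using assms(3) unfolding p_def q_def by algebra+
  have PQ: "p (g y) = P y" "q (g y) = Q y" for y
    using assms(3) unfolding p_def q_def g_def by (simp_all, algebra+)
  have U: "open ?U"
    unfolding q_def by (intro open_Collect_less continuous_intros)
  have V: "open ?V"
    by (intro open_Collect_less continuous_intros)
  have f: "C1_on ?f ?U"
    by (rule C1_onI[where D = "\<lambda>x k. (t * p k * (1 - 2 * h * q x) + t * p x * (- 2 * h * q k),
        - 2 * h * q k)"])
      (auto simp: p_def q_def algebra_simps intro!: derivative_eq_intros continuous_intros)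
  define dP where "dP y k = (fst k * (1 + snd y) - fst y * snd k) / (t * (1 + snd y) ^ 2)"
    for y k :: "real \<times> real"
  have P: "(P has_derivative dP y) (at y)" if "y \<in> ?V" for y
  proof -
    have "1 + snd y \<noteq> 0"
      using that by auto
    then show ?thesis
      unfolding P_def dP_def using assms(1)
      by (auto intro!: derivative_eq_intros simp: fun_eq_iff)
        (simp add: divide_simps power2_eq_square, algebra)?
  qed
  have g: "C1_on g ?V"
  \<comment> \<open>\<open>Q\<close> is linear, hence its own derivative; \<open>dP\<close> comes
    from the quotient rule.\<close>
  proof (rule C1_onI[where D = "\<lambda>y k. (m1 * dP y k - m2 * Q k, m2 * dP y k + m1 * Q k)"])
    show "(g has_derivative (\<lambda>k. (m1 * dP y k - m2 * Q k, m2 * dP y k + m1 * Q k))) (at y)"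
      if "y \<in> ?V" for y
      unfolding g_def Q_def using assms(2)
      by (auto intro!: derivative_eq_intros P[OF that])
    show "continuous_on ?V (\<lambda>y. (m1 * dP y k - m2 * Q k, m2 * dP y k + m1 * Q k))" for k
      unfolding dP_def using assms(1) by (intro continuous_intros) auto
  qed
  have C1_cont: "continuous_on S F" if "C1_on F S" for F :: "real \<times> real \<Rightarrow> real \<times> real" and S
    using that unfolding C1_on_def
    by (meson continuous_at_imp_continuous_on has_derivative_continuous)
  have "homeomorphism ?U ?V ?f g"
  proof (rule homeomorphismI)
    show "?f ` ?U \<subseteq> ?V"
      by auto
    show "g ` ?V \<subseteq> ?U"
      using assms(2) by (intro image_subsetI) (simp add: PQ Q_def)
    show "g (?f x) = x" if "x \<in> ?U" for x
    proof -
      have "P (?f x) = p x" "Q (?f x) = q x"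
        using that assms by (auto simp: P_def Q_def)
      then show ?thesis
        by (simp add: g_def pq)
    qed
    show "?f (g y) = y" if "y \<in> ?V" for y
      unfolding PQ using that assms by (auto simp: P_def Q_def prod_eq_iff)
  qed (use f g C1_cont in auto)
  moreover have "0 \<in> ?U"
    by (simp add: q_def)
  ultimately show ?thesis
    unfolding local_diffeomorphism_at_def using U V f g by blast
qed

section \<open>The points \<open>z_tau\<close>\<close>

lemma norm_z_tau:
  assumes "d \<ge> 2" "\<tau> ^ (d + 1) = 1"
  shows "norm (z_tau d \<tau>) = real d powr (- (1 / (real d - 1)))"
proof -
  have "norm \<tau> ^ (d + 1) = 1"
    using assms(2) by (metis norm_one norm_power)
  then have "norm \<tau> = 1"
    by (intro power_eq_imp_eq_base[of _ "d + 1" 1]) auto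
  then show ?thesis
    by (simp add: z_tau_def norm_mult)
qed

lemma powr_parabolic_radius:
  assumes "d \<ge> 2"
  shows "(real d powr (- (1 / (real d - 1)))) ^ (d - 1) = 1 / d"
proof -
  have "(real d powr (- (1 / (real d - 1)))) ^ (d - 1) =
      real d powr (- (1 / (real d - 1)) * real (d - 1))"
    using assms by (simp add: powr_powr flip: powr_realpow)
  also have "- (1 / (real d - 1)) * real (d - 1) = - 1"
    using assms by (simp add: of_nat_diff)
  finally show ?thesis
    using assms by (simp add: powr_minus divide_inverse)
qed

lemma cis_pi_power: "cis (pi / (real d + 1)) ^ (d + 1) = - 1"
  by (simp only: Complex.DeMoivre) (simp add: add.commute)

lemma z_tau_power:
  assumes "d \<ge> 2" "\<tau> ^ (d + 1) = 1"
  shows "z_tau d \<tau> ^ (d + 1) = - of_real (norm (z_tau d \<tau>) ^ (d + 1))"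
proof -
  have "z_tau d \<tau> ^ (d + 1) = - of_real ((real d powr (- (1 / (real d - 1)))) ^ (d + 1))"
    unfolding z_tau_def power_mult_distrib cis_pi_power assms(2) by simp
  then show ?thesis
    by (simp only: norm_z_tau[OF assms])
qed

text \<open>The first equation fixes the modulus; the second makes \<open>z\<close> a
  \<open>(d + 1)\<close>-th root of a negative number, so dividing by the modulus and
  \<open>cis (pi / (d + 1))\<close> leaves a root of unity.\<close>

lemma obtain_z_tau:
  assumes "d \<ge> 2" "norm z ^ (d - 1) = 1 / d" "z ^ (d + 1) = - of_real (norm z ^ (d + 1))"
  obtains \<tau> where "\<tau> ^ (d + 1) = 1" "z = z_tau d \<tau>"
proof
  define r where "r = real d powr (- (1 / (real d - 1)))"
  have r: "r > 0"
    using assms(1) by (simp add: r_def)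
  have "norm z ^ (d - 1) = r ^ (d - 1)"
    using assms(2) powr_parabolic_radius[OF assms(1)] by (simp add: r_def)
  then have n: "norm z = r"
    by (rule power_eq_imp_eq_base) (use r assms(1) in auto)
  let ?\<tau> = "z / (of_real r * cis (pi / (real d + 1)))"
  show "?\<tau> ^ (d + 1) = 1"
    unfolding power_divide power_mult_distrib cis_pi_power assms(3) n
    using r by simp
  show "z = z_tau d ?\<tau>"
    using r by (simp add: z_tau_def r_def[symmetric])
qed

text \<open>This form matches the fixed point equation \<open>c = z - cnj z ^ d\<close> once
  \<open>cnj z ^ d = - z / d\<close> is known.\<close>

lemma c_tau_eq:
  assumes "d \<ge> 2"
  shows "c_tau d \<tau> = z_tau d \<tau> * (1 + 1 / of_nat d)"
proof -
  have "- (real d / (real d - 1)) = - (1 / (real d - 1)) - 1"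
    using assms by (simp add: field_simps)
  then have eq: "real d powr (- (real d / (real d - 1))) = real d powr (- (1 / (real d - 1))) / real d"
    using assms by (simp only: powr_diff) simp
  show ?thesis
    unfolding c_tau_def z_tau_def eq using assms by (simp add: field_simps)
qed

text \<open>Multiplying by \<open>z * cnj z\<close> gives \<open>cnj (z ^ (d + 1)) * z\<close>, a
  negative real multiple of \<open>z\<close>.\<close>

lemma cnj_power_eq:
  assumes "d \<ge> 2" "norm z ^ (d - 1) = 1 / d" "z ^ (d + 1) = - of_real (norm z ^ (d + 1))"
  shows "cnj z ^ d = - z / of_nat d"
proof -
  have z: "z \<noteq> 0"
    using assms(1,2) by (auto simp: power_0_left)
  have "cnj z ^ d * of_real (norm z ^ 2) = cnj (z ^ (d + 1)) * z"
    by (simp only: complex_norm_square) (simp add: mult_ac)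
  also have "\<dots> = - of_real (norm z ^ (d - 1) * norm z ^ 2) * z"
    unfolding assms(3) using assms(1) by (simp flip: power_add)
  finally have "cnj z ^ d * of_real (norm z ^ 2) = (- z / of_nat d) * of_real (norm z ^ 2)"
    unfolding assms(2) by simp
  then show ?thesis
    using z by (simp only: mult_cancel_right) simp
qed

lemma parabolic_multiplier_sqrt:
  assumes "d \<ge> 2" "norm (of_nat d * cnj z ^ (d - 1)) = 1"
  obtains \<mu> where "norm \<mu> = 1" "\<mu> ^ 2 = of_nat d * cnj z ^ (d - 1)"
proof
  let ?w = "of_nat d * cnj z ^ (d - 1)"
  show "csqrt ?w ^ 2 = ?w"
    by (rule power2_csqrt)
  then have "norm (csqrt ?w) ^ 2 = 1"
    using assms(2) by (metis norm_power)
  then show "norm (csqrt ?w) = 1"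
    by (simp add: power2_eq_1_iff)
qed

text \<open>\<open>\<mu> / z\<close> is purely imaginary iff its square is negative, and
  \<open>(\<mu> / z)\<^sup>2 = d * cnj z ^ (d + 1) / norm z ^ 4\<close>.\<close>

lemma Re_multiplier_sqrt_eq_0_iff:
  assumes "d \<ge> 2" "z \<noteq> 0" "norm \<mu> = 1" "\<mu> ^ 2 = of_nat d * cnj z ^ (d - 1)"
  shows "Re (cnj (\<mu> / z)) = 0 \<longleftrightarrow> z ^ (d + 1) = - of_real (norm z ^ (d + 1))"
proof -
  define r where "r = norm z"
  have r: "r > 0" "of_nat d * r ^ (d - 1) = 1"
    using assms(2) arg_cong[OF assms(4), of norm] assms(3)
    by (auto simp: r_def norm_mult norm_power)
  have zz: "z * cnj z = of_real (r ^ 2)"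
    by (simp only: r_def complex_norm_square)
  define \<rho> where "\<rho> = cnj (\<mu> / z)"
  have n\<rho>: "norm \<rho> = 1 / r"
    using assms(3) by (simp add: \<rho>_def r_def norm_divide)
  have "\<rho> ^ 2 * of_real (r ^ 2) ^ 2 = cnj (\<mu> ^ 2) * z ^ 2"
    unfolding zz[symmetric] \<rho>_def using assms(2) by (simp add: power_divide power_mult_distrib)
  also have "\<dots> = of_nat d * z ^ (d + 1)"
    unfolding assms(4) using assms(1) by (simp add: mult.assoc flip: power_add)
  finally have sq: "\<rho> ^ 2 * of_real (r ^ 4) = of_nat d * z ^ (d + 1)"
    by (simp flip: power_mult)
  \<comment> \<open>The real part of \<open>\<rho> ^ 2\<close> is
    \<open>Re \<rho> ^ 2 - Im \<rho> ^ 2\<close>, which equals minus the squared modulus only if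
    \<open>Re \<rho> = 0\<close>.\<close>
  have "Re \<rho> = 0 \<longleftrightarrow> \<rho> ^ 2 = - of_real (norm \<rho> ^ 2)"
  proof
    assume "Re \<rho> = 0"
    then show "\<rho> ^ 2 = - of_real (norm \<rho> ^ 2)"
      unfolding cmod_power2 by (simp add: complex_eq_iff power2_eq_square)
  next
    assume "\<rho> ^ 2 = - of_real (norm \<rho> ^ 2)"
    then have "Re (\<rho> ^ 2) = - (norm \<rho> ^ 2)"
      by simp
    then show "Re \<rho> = 0"
      unfolding cmod_power2 by (simp add: power2_eq_square)
  qed
  also have "\<dots> \<longleftrightarrow> \<rho> ^ 2 * of_real (r ^ 4) = - of_real (norm \<rho> ^ 2) * of_real (r ^ 4)"
    using r(1) by (simp only: mult_cancel_right) simp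
  also have "- of_real (norm \<rho> ^ 2) * of_real (r ^ 4) = (- of_real (r ^ 2) :: complex)"
    unfolding n\<rho> using r(1) by (simp add: power_divide field_simps flip: power_add)
  also have "\<dots> = of_nat d * (- of_real (r ^ (d + 1)))"
  proof -
    have "r ^ 2 = real d * r ^ (d + 1)"
    proof -
      have "real d * r ^ (d + 1) = (real d * r ^ (d - 1)) * r ^ 2"
        using assms(1) by (simp add: mult.assoc flip: power_add)
      then show ?thesis
        using r(2) by (simp only: mult_1)
    qed
    then show ?thesis by simp
  qed
  finally show ?thesis
    unfolding sq mult_cancel_left using assms(1) by (simp add: \<rho>_def r_def)
qed

section \<open>Normal forms and generic unfoldings in codimensions 1 and 2\<close>

lemma multicorn_codim_1:
  assumes "d \<ge> 2" "z0 \<noteq> 0" "norm \<mu> = 1" "\<mu> ^ 2 = of_nat d * cnj z0 ^ (d - 1)"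
    and "cnj z0 ^ d + c = z0" "Re (cnj (\<mu> / z0)) \<noteq> 0"
  shows "parabolic_of_codim 1 (multicorn d c) z0"
    and "generic_unfolding (\<lambda>\<eta> :: real. multicorn d (c + of_real \<eta> * \<mu>)) z0"
proof -
  define A where "A = (of_nat d - 1) / 2 * cnj (\<mu> / z0)"
  define B where "B = (of_nat d - 1) * (of_nat d - 2) / 6 * cnj (\<mu> / z0) ^ 2"
  \<comment> \<open>For imaginary \<open>\<alpha>\<close> the quadratic coefficient is
    \<open>(A + 2 * \<alpha>) / t\<close>; this \<open>\<alpha>\<close> cancels \<open>Im A\<close>,
    and \<open>t = 2 * Re A\<close> then scales it to 1/2.\<close>
  define \<alpha> where "\<alpha> = - \<i> * of_real (Im A / 2)"
  define t where "t = 2 * Re A"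
  let ?b = "unfolding_coeff A B \<alpha> t"
  have "A = of_real ((real d - 1) / 2) * cnj (\<mu> / z0)"
    by (simp add: A_def)
  then have ReA: "Re A = (real d - 1) / 2 * Re (cnj (\<mu> / z0))"
    by (simp only: Re_complex_of_real Im_complex_of_real times_complex.sel)
  have t: "t \<noteq> 0"
    using assms(1,6) unfolding t_def ReA by (simp del: complex_cnj_divide)
  have "A - cnj \<alpha> + \<alpha> = of_real (Re A)"
    by (simp add: \<alpha>_def complex_eq_iff)
  then have b: "?b 0 j = of_bool (j = 1) + of_bool (j = 1 + 1) / 2" if "j \<le> 1 + 1" for j
    using that t by (auto simp: unfolding_coeff_def Let_def t_def le_Suc_eq)
  show "parabolic_of_codim 1 (multicorn d c) z0"
    by (rule parabolic_of_codim_multicorn[OF assms(1-5) t, where \<alpha> = \<alpha>])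
      (use b in \<open>auto simp: A_def B_def\<close>)
  have mu: "\<mu> \<noteq> 0"
    using assms(3) by auto
  have e: "bounded_linear (\<lambda>\<eta> :: real. of_real \<eta> * \<mu>)"
    by (rule bounded_linear_compose[OF bounded_linear_mult_left bounded_linear_of_real])
  \<comment> \<open>Moving \<open>c\<close> in the direction \<open>\<mu>\<close> makes
    \<open>\<delta> = \<eta>\<close> real, so \<open>\<alpha> * \<delta> ^ 2\<close> is
    imaginary.\<close>
  have "Re (?b (of_real \<eta>) 0) = t * \<eta>" for \<eta> :: real
    by (simp add: unfolding_coeff_def Let_def \<alpha>_def power2_eq_square)
  then have diffeo: "local_diffeomorphism_at
      (\<lambda>\<eta>. \<Sum>i\<in>(Basis :: real set). Re (?b (of_real \<eta> * \<mu> / \<mu>) 0 - of_bool ((0::nat) = 1)) *\<^sub>R i) (0 :: real)"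
    using local_diffeomorphism_at_real_mult[OF t, of 0] mu by simp
  have n: "bij_betw (\<lambda>_. 0) (Basis :: real set) {..<DIM(real)}"
    by (simp add: bij_betw_def lessThan_Suc)
  show "generic_unfolding (\<lambda>\<eta> :: real. multicorn d (c + of_real \<eta> * \<mu>)) z0"
  proof (rule generic_unfolding_multicorn[OF assms(1-5) t _ _ e n,
        where \<alpha> = \<alpha>, folded A_def B_def])
    show "DIM(real) = 1 \<or> DIM(real) = 2"
      by simp
    show "?b 0 j = of_bool (j = 1) + of_bool (j = DIM(real) + 1) / 2" if "j \<le> DIM(real) + 1" for j
      using b that by simp
  qed (rule diffeo)
qed

lemma multicorn_codim_2:
  assumes "d \<ge> 2" "z0 \<noteq> 0" "norm \<mu> = 1" "\<mu> ^ 2 = of_nat d * cnj z0 ^ (d - 1)"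
    and "cnj z0 ^ d + c = z0" "Re (cnj (\<mu> / z0)) = 0"
  shows "parabolic_of_codim 2 (multicorn d c) z0"
    and "generic_unfolding (\<lambda>(x :: real, y :: real). multicorn d (c + Complex x y)) z0"
proof -
  define \<rho> where "\<rho> = cnj (\<mu> / z0)"
  define A where "A = (of_nat d - 1) / 2 * \<rho>"
  define B where "B = (of_nat d - 1) * (of_nat d - 2) / 6 * \<rho> ^ 2"
  \<comment> \<open>Since \<open>A\<close> is imaginary, so is \<open>\<alpha>\<close>, and
    \<open>A - cnj \<alpha> + \<alpha> = 0\<close>: the quadratic term disappears. The cubic
    coefficient before scaling is \<open>B - A ^ 2 = S > 0\<close>, which \<open>t\<close>
    normalizes to 1/2; \<open>h\<close> is \<open>Im \<alpha>\<close>.\<close>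
  define \<alpha> where "\<alpha> = - A / 2"
  define l where "l = Im \<rho>"
  define S where "S = (real d ^ 2 - 1) / 12 * l ^ 2"
  define t where "t = sqrt (2 * S)"
  define h where "h = - (real d - 1) / 4 * l"
  let ?b = "unfolding_coeff A B \<alpha> t"
  have mu: "\<mu> \<noteq> 0"
    using assms(3) by auto
  have \<rho>: "\<rho> = \<i> * of_real l"
    using assms(6) by (simp add: l_def \<rho>_def complex_eq_iff)
  have "\<rho> \<noteq> 0"
    using mu assms(2) by (simp add: \<rho>_def)
  then have l: "l \<noteq> 0"
    using \<rho> by auto
  have d: "real d \<ge> 2"
    using assms(1) by simp
  have "real d ^ 2 - 1 > 0"
    using d by (simp add: one_less_power)
  then have S: "S > 0"
    using l by (simp add: S_def)
  then have t: "t \<noteq> 0" "t ^ 2 = 2 * S"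
    by (auto simp: t_def)
  have BA: "B - A ^ 2 = of_real S"
    unfolding A_def B_def S_def \<rho> by (simp add: power2_eq_square field_simps)
  have \<alpha>: "\<alpha> = \<i> * of_real h" and cA: "cnj \<alpha> = - \<alpha>"
    unfolding \<alpha>_def A_def h_def \<rho> by (simp_all add: field_simps)
  have A: "A = - 2 * \<alpha>"
    by (simp add: \<alpha>_def)
  have h: "h \<noteq> 0"
    using l d by (simp add: h_def)
  have b3: "(B + 2 * \<alpha> * A) / of_real t ^ 2 = 1 / 2"
  proof -
    have "B + 2 * \<alpha> * A = of_real S"
      unfolding BA[symmetric] by (simp add: \<alpha>_def power2_eq_square)
    moreover have "(of_real t ^ 2 :: complex) = 2 * of_real S"
      unfolding of_real_power[symmetric] t(2) by simp
    ultimately show ?thesis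
      using S by simp
  qed
  have b: "?b 0 j = of_bool (j = 1) + of_bool (j = 2 + 1) / 2" if "j \<le> 2 + 1" for j
    using that b3 t(1) by (auto simp: unfolding_coeff_def Let_def le_Suc_eq cA A)
  show "parabolic_of_codim 2 (multicorn d c) z0"
    by (rule parabolic_of_codim_multicorn[OF assms(1-5) t(1), where \<alpha> = \<alpha>])
      (use b in \<open>auto simp: A_def B_def \<rho>_def\<close>)
  define e :: "real \<times> real \<Rightarrow> complex" where "e x = of_real (fst x) + \<i> * of_real (snd x)" for x
  have e: "bounded_linear e"
    unfolding e_def
    by (intro bounded_linear_add bounded_linear_const_mult bounded_linear_fst bounded_linear_snd
        bounded_linear_compose[OF bounded_linear_of_real])
  define n :: "real \<times> real \<Rightarrow> nat" where "n i = (if i = (1, 0) then 0 else 1)" for i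
  \<comment> \<open>\<open>p\<close> and \<open>q\<close> are the real and imaginary parts of
    \<open>\<delta> = e x / \<mu>\<close>, the parameter displacement seen in the rotated
    frame.\<close>
  define p where "p x = Re \<mu> * fst x + Im \<mu> * snd x" for x :: "real \<times> real"
  define q where "q x = Re \<mu> * snd x - Im \<mu> * fst x" for x :: "real \<times> real"
  have "1 / \<mu> = cnj \<mu>"
    using assms(3) mu by (simp add: field_simps complex_norm_square[symmetric])
  then have "e x / \<mu> = e x * cnj \<mu>" for x
    by (metis mult.right_neutral times_divide_eq_right)
  then have \<delta>: "e x / \<mu> = of_real (p x) + \<i> * of_real (q x)" for x
    by (simp add: e_def p_def q_def complex_eq_iff)
  have "Re (?b (e x / \<mu>) 0) = t * p x * (1 - 2 * h * q x)" for x
    unfolding unfolding_coeff_def Let_def \<alpha> \<delta> by (simp add: power2_eq_square algebra_simps)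
  moreover have "Re (?b (e x / \<mu>) 1 - 1) = - 2 * h * q x" for x
    unfolding unfolding_coeff_def Let_def \<alpha> \<delta> by simp
  ultimately have "(\<Sum>i\<in>Basis. Re (?b (e x / \<mu>) (n i) - of_bool (n i = 1)) *\<^sub>R i) =
      (t * p x * (1 - 2 * h * q x), - 2 * h * q x)" for x
    by (simp add: sum_Basis_prod_eq n_def)
  moreover have "Re \<mu> ^ 2 + Im \<mu> ^ 2 = 1"
    using assms(3) by (simp add: cmod_def)
  ultimately have diffeo: "local_diffeomorphism_at
      (\<lambda>x. \<Sum>i\<in>Basis. Re (?b (e x / \<mu>) (n i) - of_bool (n i = 1)) *\<^sub>R i) 0"
    using local_diffeomorphism_at_rotated_shear[OF t(1) h, of "Re \<mu>" "Im \<mu>"]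
    by (simp only: p_def q_def)
  have n: "bij_betw n Basis {..<DIM(real \<times> real)}"
    by (auto simp: bij_betw_def inj_on_def n_def Basis_prod_def lessThan_Suc numeral_2_eq_2)
  have "generic_unfolding (\<lambda>x. multicorn d (c + e x)) z0"
  proof (rule generic_unfolding_multicorn[OF assms(1-5) t(1) _ _ e n,
        where \<alpha> = \<alpha>, folded \<rho>_def, folded A_def B_def])
    show "DIM(real \<times> real) = 1 \<or> DIM(real \<times> real) = 2"
      by simp
    show "?b 0 j = of_bool (j = 1) + of_bool (j = DIM(real \<times> real) + 1) / 2"
      if "j \<le> DIM(real \<times> real) + 1" for j
      using b that by simp
  qed (rule diffeo)
  also have "(\<lambda>x. multicorn d (c + e x)) = (\<lambda>(x, y). multicorn d (c + Complex x y))"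
    by (simp add: e_def fun_eq_iff Complex_eq)
  finally show "generic_unfolding (\<lambda>(x :: real, y :: real). multicorn d (c + Complex x y)) z0" .
qed

theorem proposition6p1:
  fixes d :: nat
  assumes "d \<ge> 2"
  shows "card (c_tau d ` {\<tau>. \<tau> ^ (d + 1) = 1}) = d + 1 \<and>
    (\<forall>\<tau>. \<tau> ^ (d + 1) = 1 \<longrightarrow>
       parabolic_of_codim 2 (multicorn d (c_tau d \<tau>)) (z_tau d \<tau>) \<and>
       generic_unfolding (\<lambda>(x :: real, y :: real). multicorn d (c_tau d \<tau> + Complex x y))
         (z_tau d \<tau>)) \<and>
    (\<forall>c z. c \<notin> c_tau d ` {\<tau>. \<tau> ^ (d + 1) = 1} \<and> parabolic_fixed_point (multicorn d c) z \<longrightarrow>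
       parabolic_of_codim 1 (multicorn d c) z \<and>
       (\<exists>\<gamma> :: real \<Rightarrow> complex. real_analytic_at \<gamma> 0 \<and> \<gamma> 0 = c \<and>
          generic_unfolding (\<lambda>\<eta>. multicorn d (\<gamma> \<eta>)) z))"
proof (intro conjI allI impI; (elim conjE)?)
  \<comment> \<open>\<open>c_tau d\<close> is multiplication by a nonzero constant, hence injective
    on the roots of unity.\<close>
  have "(real d + 1) * real d powr (- (real d / (real d - 1))) \<noteq> 0"
    using assms by simp
  then have "inj (c_tau d)"
    unfolding c_tau_def[abs_def] inj_on_def
    by (simp only: mult_cancel_left mult_eq_0_iff[of "of_real _"] of_real_eq_0_iff cis_neq_zero) simp
  then have "card (c_tau d ` {\<tau>. \<tau> ^ (d + 1) = 1}) = card {\<tau> :: complex. \<tau> ^ (d + 1) = 1}"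
    by (intro card_image) (auto intro: inj_on_subset)
  also have "\<dots> = d + 1"
    by (rule card_roots_unity_eq) simp
  finally show "card (c_tau d ` {\<tau>. \<tau> ^ (d + 1) = 1}) = d + 1" .
next
  fix \<tau> :: complex
  assume \<tau>: "\<tau> ^ (d + 1) = 1"
  let ?z = "z_tau d \<tau>"
  have n: "norm ?z ^ (d - 1) = 1 / d"
    unfolding norm_z_tau[OF assms \<tau>] by (rule powr_parabolic_radius[OF assms])
  note pow = z_tau_power[OF assms \<tau>]
  have z: "?z \<noteq> 0"
    using norm_z_tau[OF assms \<tau>] assms by auto
  have fixed: "cnj ?z ^ d + c_tau d \<tau> = ?z"
    unfolding cnj_power_eq[OF assms n pow] c_tau_eq[OF assms] by (simp add: algebra_simps)
  have "norm (of_nat d * cnj ?z ^ (d - 1)) = 1"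
    using n assms by (simp add: norm_mult norm_power)
  then obtain \<mu> where \<mu>: "norm \<mu> = 1" "\<mu> ^ 2 = of_nat d * cnj ?z ^ (d - 1)"
    using parabolic_multiplier_sqrt[OF assms] by blast
  have "Re (cnj (\<mu> / ?z)) = 0"
    using Re_multiplier_sqrt_eq_0_iff[OF assms z \<mu>] pow by blast
  from multicorn_codim_2[OF assms z \<mu> fixed this]
  show "parabolic_of_codim 2 (multicorn d (c_tau d \<tau>)) ?z"
    and "generic_unfolding (\<lambda>(x :: real, y :: real). multicorn d (c_tau d \<tau> + Complex x y)) ?z" .
next
  fix c z
  assume c: "c \<notin> c_tau d ` {\<tau>. \<tau> ^ (d + 1) = 1}"
    and "parabolic_fixed_point (multicorn d c) z"
  then have fixed: "cnj z ^ d + c = z" and mult: "norm (of_nat d * cnj z ^ (d - 1)) = 1"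
    using parabolic_fixed_point_multicorn_iff[OF assms] by auto
  have n: "norm z ^ (d - 1) = 1 / d"
    using mult assms by (simp add: norm_mult norm_power field_simps)
  then have z: "z \<noteq> 0"
    using assms by (auto simp: power_0_left)
  obtain \<mu> where \<mu>: "norm \<mu> = 1" "\<mu> ^ 2 = of_nat d * cnj z ^ (d - 1)"
    using parabolic_multiplier_sqrt[OF assms mult] by blast
  \<comment> \<open>Otherwise \<open>z\<close> would be some \<open>z_tau d \<tau>\<close>, and the
    fixed point equation would force \<open>c = c_tau d \<tau>\<close>, an excluded
    parameter.\<close>
  have "Re (cnj (\<mu> / z)) \<noteq> 0"
  proof
    assume "Re (cnj (\<mu> / z)) = 0"
    then have pow: "z ^ (d + 1) = - of_real (norm z ^ (d + 1))"
      using Re_multiplier_sqrt_eq_0_iff[OF assms z \<mu>] by blast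
    then obtain \<tau> where \<tau>: "\<tau> ^ (d + 1) = 1" "z = z_tau d \<tau>"
      using obtain_z_tau[OF assms n] by blast
    have "c = z * (1 + 1 / of_nat d)"
      using fixed cnj_power_eq[OF assms n pow] by (simp add: algebra_simps)
    then have "c = c_tau d \<tau>"
      by (simp add: \<tau>(2) c_tau_eq[OF assms])
    with \<tau>(1) c show False by blast
  qed
  note codim = multicorn_codim_1[OF assms z \<mu> fixed this]
  show "parabolic_of_codim 1 (multicorn d c) z"
    by (rule codim(1))
  \<comment> \<open>The subfamily is the real line through \<open>c\<close> in the direction
    \<open>\<mu>\<close>.\<close>
  have "polynomial_map 0 (\<lambda>\<eta> :: real. c + of_real \<eta> * \<mu>)"
    by (intro polynomial_map.add polynomial_map_mult polynomial_map_const
        polynomial_map_bounded_linear bounded_linear_of_real)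
  then show "\<exists>\<gamma> :: real \<Rightarrow> complex. real_analytic_at \<gamma> 0 \<and> \<gamma> 0 = c \<and>
      generic_unfolding (\<lambda>\<eta>. multicorn d (\<gamma> \<eta>)) z"
    using codim(2) by (intro exI[of _ "\<lambda>\<eta>. c + of_real \<eta> * \<mu>"])
      (simp add: polynomial_map_real_analytic_at)
qed

end
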